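(* Consider the ordinary differential equation $$\alpha_{xx}+6\alpha\alpha_x+4\alpha^3=0$$ for a real-valued function $\alpha=\alpha(x)$ on an open interval. Besides the three special solutions $$\alpha(x)=0,\qquad \alpha(x)=\frac{1}{x+c_1},\qquad \alpha(x)=\frac{1}{2(x+c_1)},$$ the general solution is of the form $$\alpha(x)=\frac{x+c_1}{(x+c_1)^2+c_2},$$ which depends on two real constants $c_1$ and $c_2$ with $c_2\neq 0$. (These are a complete set of solutions.)
   Context: Solutions are smooth real-valued functions of $x$ on an open interval; $c_1,c_2$ denote real constants. "Complete set of solutions" means that every solution on an open interval is of one of the listed forms (with the denominators nonvanishing on that interval), and each listed function is a solution where defined. *)

theory Defs
  imports "HOL-Analysis.Analysis"
begin

definition open_interval :: "real set \<Rightarrow> bool" where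
  "open_interval I \<longleftrightarrow> open I \<and> is_interval I \<and> I \<noteq> {}"

(* Intended for open S only: deriv is the two-sided derivative, so on an open set
   the iterated derivatives depend only on the restriction of f to S. *)
definition smooth_on :: "(real \<Rightarrow> real) \<Rightarrow> real set \<Rightarrow> bool" where
  "smooth_on f S \<longleftrightarrow> (\<forall>n. \<forall>x\<in>S. (deriv ^^ n) f differentiable (at x))"

(* Only the values of \<alpha> on I are relevant. *)
definition is_solution_on :: "(real \<Rightarrow> real) \<Rightarrow> real set \<Rightarrow> bool" where
  "is_solution_on \<alpha> I \<longleftrightarrow>
     smooth_on \<alpha> I \<and>
     (\<forall>x\<in>I. deriv (deriv \<alpha>) x + 6 * \<alpha> x * deriv \<alpha> x + 4 * \<alpha> x ^ 3 = 0)"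

end

theory Submission
  imports Defs
begin

text \<open>
  The substitution \<open>\<alpha> = u' / (2 u)\<close>, that is \<open>u = exp (2 \<integral> \<alpha>)\<close>, linearises the equation:
  it gives \<open>u''' = 2 (\<alpha>'' + 6 \<alpha> \<alpha>' + 4 \<alpha>\<^sup>3) u\<close>. Hence \<open>\<alpha>\<close> is a solution iff \<open>u\<close> is a polynomial
  of degree at most two without zeros on the interval. Degrees 0 and 1 yield \<open>0\<close> and
  \<open>1 / (2 (x + c\<^sub>1))\<close>; in degree 2, completing the square yields the other two families.
\<close>

text \<open>Supplies the integral of \<open>\<alpha>\<close> in the substitution. As
  \<open>I\<close> may be unbounded, it is treated as the interval between its infimum and supremum
  in the extended reals, the setting of \<open>einterval_antiderivative\<close>.\<close>

lemma open_interval_antiderivative: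
  fixes f :: "real \<Rightarrow> real"
  assumes "open_interval I" and cont: "\<And>x. x \<in> I \<Longrightarrow> isCont f x"
  obtains F where "\<And>x. x \<in> I \<Longrightarrow> (F has_real_derivative f x) (at x)"
proof -
  from assms(1) have I: "open I" "is_interval I" "I \<noteq> {}"
    by (auto simp: open_interval_def)
  define a b where "a = Inf (ereal ` I)" and "b = Sup (ereal ` I)"
  have into: "x \<in> I" if "a < ereal x" "ereal x < b" for x
    using that I(2) unfolding a_def b_def Inf_less_iff less_Sup_iff
    by (auto intro: mem_is_interval_1_I less_imp_le)
  \<comment> \<open>Openness keeps the endpoints out of \<open>I\<close>: with \<open>x\<close>,
    some points on either side of \<open>x\<close> also lie in \<open>I\<close>.\<close>
  have bounds: "a < ereal x \<and> ereal x < b" if "x \<in> I" for x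
  proof -
    from I(1) that obtain e where e: "e > 0" "ball x e \<subseteq> I"
      by (auto simp: open_contains_ball)
    then have "x - e/2 \<in> I" "x + e/2 \<in> I"
      by (auto simp: subset_iff dist_real_def)
    then have "a \<le> ereal (x - e/2)" "ereal (x + e/2) \<le> b"
      unfolding a_def b_def by (auto intro: Inf_lower Sup_upper)
    moreover have "ereal (x - e/2) < ereal x" "ereal x < ereal (x + e/2)"
      using e(1) by auto
    ultimately show ?thesis
      by (meson le_less_trans less_le_trans)
  qed
  with I(3) have "a < b"
    by (meson ex_in_conv less_trans)
  from einterval_antiderivative[OF this, of f] cont into bounds that show ?thesis
    by (metis has_real_derivative_iff_has_vector_derivative)
qed

lemma deriv_zero_constant_on_open_interval:
  fixes f :: "real \<Rightarrow> real"
  assumes "open_interval I" and "\<And>x. x \<in> I \<Longrightarrow> (f has_real_derivative 0) (at x)"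
  obtains c where "\<And>x. x \<in> I \<Longrightarrow> f x = c"
proof -
  have "convex I"
    using assms(1) by (simp add: open_interval_def is_interval_convex)
  then show ?thesis
    using that has_field_derivative_zero_constant[of I f] assms(2)
    by (metis has_field_derivative_at_within)
qed

text \<open>A derivative depends only on values near the point, so a closed form valid on
  \<open>S\<close> may be differentiated in place of \<open>f\<close>, whatever \<open>f\<close> is
  elsewhere.\<close>

lemma deriv_eq_on_open:
  fixes f :: "real \<Rightarrow> real"
  assumes "open S" "x \<in> S" and "\<And>y. y \<in> S \<Longrightarrow> f y = g y"
    and "(g has_real_derivative D) (at x)"
  shows "(f has_real_derivative D) (at x)" "deriv f x = D"
proof -
  show "(f has_real_derivative D) (at x)"
    using assms by (metis has_field_derivative_transform_within_open)
  then show "deriv f x = D"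
    by (rule DERIV_imp_deriv)
qed

text \<open>By the quotient rule, each iterated derivative is again a polynomial over a power of the
  same \<open>q\<close>, so no new poles appear.\<close>

lemma smooth_on_rational:
  fixes p q :: "real poly"
  assumes "open S" and f: "\<And>x. x \<in> S \<Longrightarrow> poly q x \<noteq> 0 \<and> f x = poly p x / poly q x"
  shows "smooth_on f S"
proof -
  \<comment> \<open>The unsimplified quotient rule. At \<open>k = 0\<close> the truncated exponent
    \<open>k - 1\<close> is harmless because of the factor \<open>real k\<close>.\<close>
  define D where "D = (\<lambda>p k x. (poly (pderiv p) x * poly q x ^ k
      - poly p x * (real k * poly q x ^ (k - 1) * poly (pderiv q) x)) / (poly q x ^ k * poly q x ^ k))"
  have D: "((\<lambda>y. poly p y / poly q y ^ k) has_real_derivative D p k x) (at x)"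
    if "x \<in> S" for x p k
    using f[OF that] unfolding D_def
    by (auto intro!: derivative_eq_intros)
  have rational: "\<exists>p k. \<forall>x\<in>S. (deriv ^^ n) f x = poly p x / poly q x ^ k" for n
  proof (induction n)
    case 0
    show ?case using f by (intro exI[of _ p] exI[of _ 1]) auto
  next
    case (Suc n)
    then obtain p k where pk: "\<And>x. x \<in> S \<Longrightarrow> (deriv ^^ n) f x = poly p x / poly q x ^ k"
      by auto
    have "(deriv ^^ Suc n) f x = D p k x" if "x \<in> S" for x
      using deriv_eq_on_open(2)[OF assms(1) that pk D[OF that]] by simp
    then show ?case
      by (intro exI[of _ "pderiv p * q ^ k - p * (smult (real k) (q ^ (k - 1)) * pderiv q)"]
          exI[of _ "k + k"]) (auto simp: D_def power_add)
  qed
  show ?thesis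
    unfolding smooth_on_def
  proof (intro allI ballI)
    fix n x assume x: "x \<in> S"
    obtain p k where pk: "\<And>x. x \<in> S \<Longrightarrow> (deriv ^^ n) f x = poly p x / poly q x ^ k"
      using rational[of n] by auto
    show "(deriv ^^ n) f differentiable (at x)"
      using deriv_eq_on_open(1)[OF assms(1) x pk D[OF x]] real_differentiable_def by blast
  qed
qed

text \<open>One verification for all four families: each is half the logarithmic derivative of a
  polynomial of degree at most two, with \<open>a = 0\<close> allowed.\<close>

lemma solution_of_quadratic:
  fixes a b d :: real
  assumes "open I"
    and f: "\<And>x. x \<in> I \<Longrightarrow> a*x\<^sup>2 + b*x + d \<noteq> 0 \<and> \<alpha> x = (2*a*x + b) / (2 * (a*x\<^sup>2 + b*x + d))"
  shows "is_solution_on \<alpha> I"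
proof -
  define Q where "Q = (\<lambda>x. a*x\<^sup>2 + b*x + d)"
  define R where "R = (\<lambda>x. 2*a*x + b)"
  have Q: "(Q has_real_derivative R x) (at x)" and R: "(R has_real_derivative 2*a) (at x)" for x
    unfolding Q_def R_def by (auto intro!: derivative_eq_intros)
  have nz: "Q x \<noteq> 0" and eq: "\<alpha> x = R x / (2 * Q x)" if "x \<in> I" for x
    using f[OF that] by (auto simp: Q_def R_def)
  have d1: "deriv \<alpha> x = a / Q x - (R x)\<^sup>2 / (2 * (Q x)\<^sup>2)" if "x \<in> I" for x
  proof (rule deriv_eq_on_open(2)[OF assms(1) that eq])
    show "((\<lambda>x. R x / (2 * Q x)) has_real_derivative a / Q x - (R x)\<^sup>2 / (2 * (Q x)\<^sup>2)) (at x)"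
      using nz[OF that]
      by (auto intro!: derivative_eq_intros Q R simp: field_simps power2_eq_square)
  qed
  have d2: "deriv (deriv \<alpha>) x = - 3 * a * R x / (Q x)\<^sup>2 + R x ^ 3 / Q x ^ 3" if "x \<in> I" for x
  proof (rule deriv_eq_on_open(2)[OF assms(1) that d1])
    show "((\<lambda>x. a / Q x - (R x)\<^sup>2 / (2 * (Q x)\<^sup>2)) has_real_derivative
        - 3 * a * R x / (Q x)\<^sup>2 + R x ^ 3 / Q x ^ 3) (at x)"
      using nz[OF that]
      by (auto intro!: derivative_eq_intros Q R simp: field_simps power2_eq_square power3_eq_cube)
  qed
  have "smooth_on \<alpha> I"
  proof (rule smooth_on_rational[OF assms(1)])
    fix x assume x: "x \<in> I"
    have "poly [:2*d, 2*b, 2*a:] x = 2 * Q x" "poly [:b, 2*a:] x = R x"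
      by (simp_all add: Q_def R_def algebra_simps power2_eq_square)
    then show "poly [:2*d, 2*b, 2*a:] x \<noteq> 0 \<and> \<alpha> x = poly [:b, 2*a:] x / poly [:2*d, 2*b, 2*a:] x"
      using nz[OF x] eq[OF x] by (simp only:) simp
  qed
  moreover have "deriv (deriv \<alpha>) x + 6 * \<alpha> x * deriv \<alpha> x + 4 * \<alpha> x ^ 3 = 0" if "x \<in> I" for x
  proof -
    \<comment> \<open>Writing \<open>s\<close> for the reciprocal of \<open>Q x\<close> turns the
      equation into a polynomial identity in \<open>a\<close>, \<open>R x\<close> and
      \<open>s\<close>.\<close>
    define s where "s = 1 / Q x"
    have "\<alpha> x = R x * s / 2" "deriv \<alpha> x = a * s - (R x)\<^sup>2 * s\<^sup>2 / 2"
      "deriv (deriv \<alpha>) x = - 3 * a * R x * s\<^sup>2 + R x ^ 3 * s ^ 3"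
      using eq[OF that] d1[OF that] d2[OF that] by (simp_all add: s_def power_divide)
    then show ?thesis
      by (simp only:) (simp add: algebra_simps power2_eq_square power3_eq_cube)
  qed
  ultimately show ?thesis
    by (simp add: is_solution_on_def)
qed

lemma quadratic_of_solution:
  assumes I: "open_interval I" and sol: "is_solution_on \<alpha> I"
  obtains a b d :: real
  where "\<And>x. x \<in> I \<Longrightarrow> a*x\<^sup>2 + b*x + d \<noteq> 0 \<and> \<alpha> x = (2*a*x + b) / (2 * (a*x\<^sup>2 + b*x + d))"
proof -
  have diff: "(deriv ^^ n) \<alpha> differentiable (at x)" if "x \<in> I" for n x
    using sol that by (simp add: is_solution_on_def smooth_on_def)
  have d1: "(\<alpha> has_real_derivative deriv \<alpha> x) (at x)" if "x \<in> I" for x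
    using diff[OF that, of 0] by (simp add: DERIV_deriv_iff_real_differentiable)
  have d2: "(deriv \<alpha> has_real_derivative - 6 * \<alpha> x * deriv \<alpha> x - 4 * \<alpha> x ^ 3) (at x)"
    if "x \<in> I" for x
  proof -
    have "deriv (deriv \<alpha>) x = - 6 * \<alpha> x * deriv \<alpha> x - 4 * \<alpha> x ^ 3"
      using sol that by (simp add: is_solution_on_def algebra_simps eq_neg_iff_add_eq_0)
    then show ?thesis
      using diff[OF that, of 1] by (simp flip: DERIV_deriv_iff_real_differentiable)
  qed
  obtain F where F: "\<And>x. x \<in> I \<Longrightarrow> (F has_real_derivative \<alpha> x) (at x)"
    using open_interval_antiderivative[OF I, of \<alpha>] d1 DERIV_isCont by blast
  define u where "u = (\<lambda>x. exp (2 * F x))"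
  have u: "(u has_real_derivative 2 * \<alpha> x * u x) (at x)" if "x \<in> I" for x
    unfolding u_def using that by (auto intro!: derivative_eq_intros F)
  \<comment> \<open>The function is u''/2. Its derivative is (\<alpha>'' + 6 \<alpha> \<alpha>' + 4
    \<alpha>^3) u, which vanishes by the equation in the form \<open>d2\<close>. The next two steps
    integrate twice more, one constant at a time.\<close>
  have const_a: "((\<lambda>x. (deriv \<alpha> x + 2 * (\<alpha> x)\<^sup>2) * u x) has_real_derivative 0) (at x)"
    if "x \<in> I" for x
    using that
    by (auto intro!: derivative_eq_intros u d1 d2 simp: algebra_simps power2_eq_square power3_eq_cube)
  obtain a where a: "\<And>x. x \<in> I \<Longrightarrow> (deriv \<alpha> x + 2 * (\<alpha> x)\<^sup>2) * u x = a"
    using deriv_zero_constant_on_open_interval[OF I const_a] by blast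
  \<comment> \<open>Here \<open>2 * \<alpha> x * u x\<close> is u', and u'' = 2a by the previous
    step.\<close>
  have const_b: "((\<lambda>x. 2 * \<alpha> x * u x - 2 * a * x) has_real_derivative 0) (at x)" if "x \<in> I" for x
    using that a[OF that]
    by (auto intro!: derivative_eq_intros u d1 simp: algebra_simps power2_eq_square)
  obtain b where b: "\<And>x. x \<in> I \<Longrightarrow> 2 * \<alpha> x * u x - 2 * a * x = b"
    using deriv_zero_constant_on_open_interval[OF I const_b] by blast
  have const_d: "((\<lambda>x. u x - a * x\<^sup>2 - b * x) has_real_derivative 0) (at x)" if "x \<in> I" for x
    using that b[OF that]
    by (auto intro!: derivative_eq_intros u simp: algebra_simps)
  obtain d where d: "\<And>x. x \<in> I \<Longrightarrow> u x - a * x\<^sup>2 - b * x = d"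
    using deriv_zero_constant_on_open_interval[OF I const_d] by blast
  show ?thesis
  proof (rule that)
    fix x assume x: "x \<in> I"
    \<comment> \<open>Positivity of the exponential makes the quadratic nonzero on \<open>I\<close>
      and allows solving u' = 2 \<alpha> u for \<alpha>.\<close>
    have "u x > 0"
      by (simp add: u_def)
    moreover have "a*x\<^sup>2 + b*x + d = u x" "2*a*x + b = 2 * \<alpha> x * u x"
      using b[OF x] d[OF x] by simp_all
    ultimately show "a*x\<^sup>2 + b*x + d \<noteq> 0 \<and> \<alpha> x = (2*a*x + b) / (2 * (a*x\<^sup>2 + b*x + d))"
      by simp
  qed
qed

theorem theorem1p2:
  fixes \<alpha> :: "real \<Rightarrow> real" and I :: "real set"
  assumes "open_interval I"
  shows "is_solution_on \<alpha> I \<longleftrightarrow>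
      (\<forall>x\<in>I. \<alpha> x = 0)
    \<or> (\<exists>c\<^sub>1::real. \<forall>x\<in>I. x + c\<^sub>1 \<noteq> 0 \<and> \<alpha> x = 1 / (x + c\<^sub>1))
    \<or> (\<exists>c\<^sub>1::real. \<forall>x\<in>I. x + c\<^sub>1 \<noteq> 0 \<and> \<alpha> x = 1 / (2 * (x + c\<^sub>1)))
    \<or> (\<exists>(c\<^sub>1::real) (c\<^sub>2::real). c\<^sub>2 \<noteq> 0 \<and>
         (\<forall>x\<in>I. (x + c\<^sub>1)\<^sup>2 + c\<^sub>2 \<noteq> 0 \<and> \<alpha> x = (x + c\<^sub>1) / ((x + c\<^sub>1)\<^sup>2 + c\<^sub>2)))"
    (is "_ \<longleftrightarrow> ?zero \<or> ?simple \<or> ?half \<or> ?general")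
proof
  assume "is_solution_on \<alpha> I"
  then obtain a b d where abd: "\<And>x. x \<in> I \<Longrightarrow>
      a*x\<^sup>2 + b*x + d \<noteq> 0 \<and> \<alpha> x = (2*a*x + b) / (2 * (a*x\<^sup>2 + b*x + d))"
    using quadratic_of_solution[OF assms] by blast
  \<comment> \<open>The degree of the quadratic selects the family.\<close>
  consider "a = 0" "b = 0" | "a = 0" "b \<noteq> 0" | "a \<noteq> 0"
    by blast
  then show "?zero \<or> ?simple \<or> ?half \<or> ?general"
  proof cases
    case 1
    then have ?zero using abd by simp
    then show ?thesis by blast
  next
    case 2
    have "x + d/b \<noteq> 0 \<and> \<alpha> x = 1 / (2 * (x + d/b))" if "x \<in> I" for x
    proof -
      have "b * x + d = b * (x + d/b)"
        using 2 by (simp add: field_simps)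
      then show ?thesis
        using abd[OF that] 2 by auto
    qed
    then have ?half by blast
    then show ?thesis by blast
  next
    case 3
    \<comment> \<open>Completing the square after dividing by \<open>a\<close>. The case
      \<open>c2 = 0\<close> is a double root, where one factor \<open>x + c1\<close> cancels and
      \<open>?simple\<close> results.\<close>
    define c1 c2 where "c1 = b / (2*a)" and "c2 = d/a - c1\<^sup>2"
    have eq: "(x + c1)\<^sup>2 + c2 \<noteq> 0 \<and> \<alpha> x = (x + c1) / ((x + c1)\<^sup>2 + c2)" if "x \<in> I" for x
    proof -
      have "a*x\<^sup>2 + b*x + d = a * ((x + c1)\<^sup>2 + c2)" "2*a*x + b = 2 * a * (x + c1)"
        using 3 by (simp_all add: c1_def c2_def field_simps power2_eq_square)
      then show ?thesis
        using abd[OF that] 3 by auto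
    qed
    show ?thesis
    proof (cases "c2 = 0")
      case True
      then have ?simple
        using eq by (intro exI[of _ c1]) (auto simp: power2_eq_square)
      then show ?thesis by blast
    next
      case False
      then have ?general using eq by blast
      then show ?thesis by blast
    qed
  qed
next
  have "open I"
    using assms by (simp add: open_interval_def)
  note sol = solution_of_quadratic[OF this]
  assume "?zero \<or> ?simple \<or> ?half \<or> ?general"
  then consider ?zero | ?simple | ?half | ?general
    by argo
  then show "is_solution_on \<alpha> I"
  proof cases
    case 1
    \<comment> \<open>The zero solution comes from the constant polynomial 1.\<close>
    then show ?thesis by (intro sol[of 0 0 1]) auto
  next
    case 2
    then obtain c1 where c1: "\<And>x. x \<in> I \<Longrightarrow> x + c1 \<noteq> 0 \<and> \<alpha> x = 1 / (x + c1)"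
      by blast
    show ?thesis
    \<comment> \<open>The coefficients of the double-root quadratic
      \<open>(x + c1)\<^sup>2\<close>.\<close>
    proof (rule sol[of 1 "2*c1" "c1\<^sup>2"])
      fix x assume x: "x \<in> I"
      have square: "1*x\<^sup>2 + 2*c1*x + c1\<^sup>2 = (x + c1)\<^sup>2" "2*1*x + 2*c1 = 2 * (x + c1)"
        by (simp_all add: algebra_simps power2_eq_square)
      show "1*x\<^sup>2 + 2*c1*x + c1\<^sup>2 \<noteq> 0 \<and>
          \<alpha> x = (2*1*x + 2*c1) / (2 * (1*x\<^sup>2 + 2*c1*x + c1\<^sup>2))"
        \<comment> \<open>Without distributing the numeral, \<open>2 * (x + c1)\<close> stays a
          product and its factors can cancel.\<close>
        unfolding square using c1[OF x] by (simp del: distrib_left_numeral add: power2_eq_square)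
    qed
  next
    case 3
    then obtain c1 where "\<And>x. x \<in> I \<Longrightarrow> x + c1 \<noteq> 0 \<and> \<alpha> x = 1 / (2 * (x + c1))"
      by blast
    then show ?thesis by (intro sol[of 0 1 c1]) auto
  next
    case 4
    then obtain c1 c2 where c: "\<And>x. x \<in> I \<Longrightarrow>
        (x + c1)\<^sup>2 + c2 \<noteq> 0 \<and> \<alpha> x = (x + c1) / ((x + c1)\<^sup>2 + c2)"
      by blast
    show ?thesis
    \<comment> \<open>The denominator \<open>(x + c1)\<^sup>2 + c2\<close>, expanded; half its
      derivative is the numerator \<open>x + c1\<close>.\<close>
    proof (rule sol[of 1 "2*c1" "c1\<^sup>2 + c2"])
      fix x assume x: "x \<in> I"
      have square: "1*x\<^sup>2 + 2*c1*x + (c1\<^sup>2 + c2) = (x + c1)\<^sup>2 + c2" "2*1*x + 2*c1 = 2 * (x + c1)"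
        by (simp_all add: algebra_simps power2_eq_square)
      show "1*x\<^sup>2 + 2*c1*x + (c1\<^sup>2 + c2) \<noteq> 0 \<and>
          \<alpha> x = (2*1*x + 2*c1) / (2 * (1*x\<^sup>2 + 2*c1*x + (c1\<^sup>2 + c2)))"
        unfolding square using c[OF x] by (simp del: distrib_left_numeral)
    qed
  qed
qed

end
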